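(* Let $t\ge 2$ and $n\ge 2t$. (i) If $t=2$, then $$\mathrm{st}(n,2K_2)=\begin{cases} n-1=\mathrm{ex}(n,P_4)=\mathrm{ex}(n,2K_2) & \text{if } 3\nmid n,\\ n=\mathrm{ex}(n,P_4)=\mathrm{ex}(n,2K_2)+1 & \text{if } 3\mid n.\end{cases}$$ (ii) If $t\ge 3$, then $\mathrm{st}(n,tK_2)=\mathrm{ex}(n,tK_2)$.
   Context: Graphs are finite and simple; $tK_2$ is the matching with $t$ edges on $2t$ vertices, $P_4$ is the path on 4 vertices. $\mathrm{ex}(n,G)$ is the maximum number of edges of a graph on $n$ vertices containing no (not necessarily induced) copy of $G$. For a non-complete graph $G$ on $k$ vertices and $n\ge k$, $\mathrm{st}(n,G)$ is the largest $m$ for which there is a graph $H$ with $n$ vertices and $m$ edges such that no subgraph $F\subseteq H$ on exactly $k$ vertices contains $G$ as a proper subgraph. *)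

theory Defs
  imports Main "HOL-Library.Ramsey"
begin

text \<open>A graph is a pair of a vertex set and an edge set; edges are two-element sets of vertices.\<close>

type_synonym 'a graph = "'a set \<times> 'a set set"

abbreviation verts :: "'a graph \<Rightarrow> 'a set" where
  "verts G \<equiv> fst G"

abbreviation edges :: "'a graph \<Rightarrow> 'a set set" where
  "edges G \<equiv> snd G"

definition simple_graph :: "'a graph \<Rightarrow> bool" where
  "simple_graph G \<longleftrightarrow> finite (verts G) \<and> edges G \<subseteq> nsets (verts G) 2"

definition subgraph :: "'a graph \<Rightarrow> 'a graph \<Rightarrow> bool" where
  "subgraph F H \<longleftrightarrow>
     simple_graph F \<and> simple_graph H \<and> verts F \<subseteq> verts H \<and> edges F \<subseteq> edges H"

definition isomorphic :: "'a graph \<Rightarrow> 'b graph \<Rightarrow> bool" where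
  "isomorphic G H \<longleftrightarrow>
     (\<exists>f. bij_betw f (verts G) (verts H) \<and> (\<lambda>e. f ` e) ` edges G = edges H)"

definition contains_copy :: "'a graph \<Rightarrow> 'b graph \<Rightarrow> bool" where
  "contains_copy H G \<longleftrightarrow> (\<exists>G'. subgraph G' H \<and> isomorphic G G')"

definition contains_proper_copy :: "'a graph \<Rightarrow> 'b graph \<Rightarrow> bool" where
  "contains_proper_copy F G \<longleftrightarrow> (\<exists>G'. subgraph G' F \<and> G' \<noteq> F \<and> isomorphic G G')"

text \<open>
  Host graphs have natural numbers as vertices; up to isomorphism this covers all finite graphs.
  In both extremal numbers the maximum is over a finite set of numbers, which is nonempty whenever
  \<open>G\<close> has an edge (lemmas below).
\<close>

definition ex_number :: "nat \<Rightarrow> 'a graph \<Rightarrow> nat" where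
  "ex_number n G =
     Max {m. \<exists>H :: nat graph. simple_graph H \<and> card (verts H) = n \<and> card (edges H) = m \<and>
                \<not> contains_copy H G}"

text \<open>Only meaningful for non-complete \<open>G\<close> and \<open>n \<ge> card (verts G)\<close>.\<close>

definition st_number :: "nat \<Rightarrow> 'a graph \<Rightarrow> nat" where
  "st_number n G =
     Max {m. \<exists>H :: nat graph. simple_graph H \<and> card (verts H) = n \<and> card (edges H) = m \<and>
                (\<nexists>F. subgraph F H \<and> card (verts F) = card (verts G) \<and> contains_proper_copy F G)}"

definition matching_graph :: "nat \<Rightarrow> nat graph" where
  "matching_graph t = ({..<2 * t}, {{2 * i, 2 * i + 1} | i. i < t})"

definition path_graph :: "nat \<Rightarrow> nat graph" where
  "path_graph k = ({..<k}, {{i, i + 1} | i. i + 1 < k})"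

lemma finite_edge_counts:
  "finite {m. \<exists>H :: nat graph. simple_graph H \<and> card (verts H) = n \<and> card (edges H) = m \<and> P H}"
proof (rule finite_subset)
  show "{m. \<exists>H :: nat graph. simple_graph H \<and> card (verts H) = n \<and> card (edges H) = m \<and> P H}
        \<subseteq> {..n choose 2}"
    by (auto simp: simple_graph_def) (metis card_mono card_nsets finite_imp_finite_nsets)
qed simp

lemma edgeless_contains_no_copy:
  assumes "edges G \<noteq> {}"
  shows "\<not> contains_copy (V, {}) G"
  using assms by (auto simp: contains_copy_def subgraph_def isomorphic_def)

lemma edgeless_contains_no_proper_copy:
  assumes "edges G \<noteq> {}" "subgraph F (V, {})"
  shows "\<not> contains_proper_copy F G"
  using assms by (fastforce simp: contains_proper_copy_def subgraph_def isomorphic_def)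

lemma ex_number_nonempty:
  assumes "edges G \<noteq> {}"
  shows "{m. \<exists>H :: nat graph. simple_graph H \<and> card (verts H) = n \<and> card (edges H) = m \<and>
            \<not> contains_copy H G} \<noteq> {}"
proof -
  have "simple_graph ({..<n}, {})" by (simp add: simple_graph_def)
  moreover have "card (verts ({..<n}, {} :: nat set set)) = n" by simp
  ultimately show ?thesis using edgeless_contains_no_copy[OF assms] by blast
qed

lemma st_number_nonempty:
  assumes "edges G \<noteq> {}"
  shows "{m. \<exists>H :: nat graph. simple_graph H \<and> card (verts H) = n \<and> card (edges H) = m \<and>
            (\<nexists>F. subgraph F H \<and> card (verts F) = card (verts G) \<and> contains_proper_copy F G)} \<noteq> {}"
proof -
  have "simple_graph ({..<n}, {})" by (simp add: simple_graph_def)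
  moreover have "card (verts ({..<n}, {} :: nat set set)) = n" by simp
  ultimately show ?thesis using edgeless_contains_no_proper_copy[OF assms] by blast
qed

end

theory Submission
  imports Defs
begin

text \<open>
  A graph on \<open>2t\<close> vertices that contains \<open>tK\<^sub>2\<close> properly is a perfect matching together with at
  least one further edge. So the condition defining \<open>st(n, tK\<^sub>2)\<close> says that every matching of
  size \<open>t\<close> in the host graph is an induced subgraph. In particular a \<open>tK\<^sub>2\<close>-free graph
  satisfies it, and therefore \<open>ex(n, tK\<^sub>2) \<le> st(n, tK\<^sub>2)\<close>.

  For \<open>t = 2\<close>, two disjoint edges joined by a third one form a \<open>P\<^sub>4\<close>, so the condition is
  \<open>P\<^sub>4\<close>-freeness and \<open>st(n, 2K\<^sub>2) = ex(n, P\<^sub>4)\<close>. The components of a \<open>P\<^sub>4\<close>-free graph are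
  isolated vertices, stars and triangles; only triangles have as many edges as vertices, which gives
  at most \<open>n\<close> edges, with equality only if \<open>3\<close> divides \<open>n\<close> (lemma \<open>path_free_card_edges\<close>).
  Disjoint triangles and stars attain the bounds. A \<open>2K\<^sub>2\<close>-free graph has pairwise intersecting
  edges, hence is a star or a triangle up to isolated vertices, and for \<open>n \<ge> 4\<close> it has at most
  \<open>n - 1\<close> edges (lemma \<open>intersecting_card_edges\<close>).

  For \<open>t \<ge> 3\<close>, let every matching of size \<open>t\<close> be induced and let at least one exist. A maximum
  matching \<open>M\<close>, of size \<open>s \<ge> t\<close>, is then induced too. The vertices that it leaves uncovered are
  independent, and each of them has neighbours in only one edge of \<open>M\<close>: otherwise exchanging an edge
  of \<open>M\<close> yields a matching of the same size that is not induced. Hence there are at most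
  \<open>s + 2(n - 2s) = 2n - 3s\<close> edges (lemma \<open>induced_matchings_card_edges\<close>). This is fewer than the
  \<open>2(n - 2)\<close> edges of \<open>K\<^bsub>2,n-2\<^esub>\<close>, which has no \<open>3K\<^sub>2\<close> (lemma \<open>ex_number_matching_graph_ge\<close>), so
  graphs containing \<open>tK\<^sub>2\<close> never beat \<open>ex(n, tK\<^sub>2)\<close>, and no exact value of it is needed.
\<close>

section \<open>Copies of matchings and of the path on four vertices\<close>

lemma simple_graph_edge:
  assumes "simple_graph H" "e \<in> edges H"
  shows "\<exists>x y. e = {x, y} \<and> x \<noteq> y \<and> x \<in> verts H \<and> y \<in> verts H"
proof -
  have "card e = 2" "e \<subseteq> verts H" using assms by (auto simp: simple_graph_def nsets_def)
  then show ?thesis by (auto simp: card_2_iff)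
qed

lemma simple_graph_edge_at:
  assumes "simple_graph H" "e \<in> edges H" "v \<in> e"
  shows "\<exists>w. e = {v, w} \<and> w \<noteq> v"
  using simple_graph_edge[OF assms(1,2)] assms(3) by (metis insertE insert_commute singletonD)

lemma simple_graph_finite_edges:
  "simple_graph H \<Longrightarrow> finite (edges H)"
  by (auto simp: simple_graph_def intro: finite_subset finite_imp_finite_nsets)

lemma simple_graph_edgeD:
  assumes "simple_graph H" "e \<in> edges H"
  shows "card e = 2" "finite e" "e \<subseteq> verts H"
  using assms by (auto simp: simple_graph_def nsets_def)

text \<open>
  The graphs isomorphic to \<open>tK\<^sub>2\<close> are exactly those with \<open>t\<close> pairwise disjoint edges that cover
  all vertices.
\<close>

lemma isomorphic_matching_graph_iff:
  assumes G: "simple_graph G"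
  shows "isomorphic (matching_graph t) G \<longleftrightarrow>
           pairwise disjnt (edges G) \<and> card (edges G) = t \<and> verts G = \<Union>(edges G)"
proof
  let ?m = "\<lambda>i::nat. {2 * i, 2 * i + 1}"
  have m: "edges (matching_graph t) = ?m ` {..<t}"
    by (auto simp: matching_graph_def)
  have U: "\<Union>(?m ` {..<t}) = {..<2 * t}"
  proof
    show "{..<2 * t} \<subseteq> \<Union>(?m ` {..<t})"
    proof
      fix k assume "k \<in> {..<2 * t}"
      then have "k div 2 < t" "k \<in> ?m (k div 2)" by auto
      then show "k \<in> \<Union>(?m ` {..<t})" by blast
    qed
  qed auto
  assume "isomorphic (matching_graph t) G"
  then obtain f where f: "bij_betw f {..<2 * t} (verts G)"
    and e: "edges G = (\<lambda>i. f ` ?m i) ` {..<t}"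
    unfolding isomorphic_def m by (auto simp: matching_graph_def image_image)
  have sub: "?m i \<subseteq> {..<2 * t}" if "i < t" for i using that by auto
  have dj: "disjnt (f ` ?m i) (f ` ?m j)" if "i < t" "j < t" "i \<noteq> j" for i j
  proof -
    have "?m i \<inter> ?m j = {}" using that(3) by auto
    then show ?thesis
      using inj_on_image_Int[OF bij_betw_imp_inj_on[OF f] sub[OF that(1)] sub[OF that(2)]]
      unfolding disjnt_def by (metis image_empty)
  qed
  have "inj_on (\<lambda>i. f ` ?m i) {..<t}"
    by (rule inj_onI) (use dj in \<open>fastforce simp: disjnt_def\<close>)
  then have "card (edges G) = t" by (simp add: e card_image)
  moreover have "pairwise disjnt (edges G)"
    unfolding e by (rule pairwiseI) (use dj in blast)
  moreover have "verts G = \<Union>(edges G)"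
    using bij_betw_imp_surj_on[OF f] U by (simp only: e flip: image_UN)
  ultimately show "pairwise disjnt (edges G) \<and> card (edges G) = t \<and> verts G = \<Union>(edges G)"
    by blast
next
  assume a: "pairwise disjnt (edges G) \<and> card (edges G) = t \<and> verts G = \<Union>(edges G)"
  have "finite (edges G)" by (rule simple_graph_finite_edges[OF G])
  then obtain h where h: "bij_betw h {..<t} (edges G)"
    using a by (metis bij_betw_from_nat_into_finite ex_bij_betw_nat_finite lessThan_atLeast0)
  have "\<forall>e\<in>edges G. \<exists>x y. e = {x, y} \<and> x \<noteq> y"
    using simple_graph_edge[OF G] by blast
  then obtain p q where pq: "\<And>e. e \<in> edges G \<Longrightarrow> e = {p e, q e} \<and> p e \<noteq> q e"
    by metis
  \<comment> \<open>The edge number \<open>i\<close> of the matching, on \<open>2i\<close> and \<open>2i + 1\<close>, goes to the edge \<open>h i\<close>.\<close>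
  define f where "f k = (if even k then p else q) (h (k div 2))" for k
  have hE: "h i \<in> edges G" if "i < t" for i
    using h that by (auto dest: bij_betwE)
  have fm: "f ` {2 * i, 2 * i + 1} = h i" if "i < t" for i
    using pq[OF hE[OF that]] by (simp add: f_def)
  have fk: "f k \<in> h (k div 2)" if "k < 2 * t" for k
  proof -
    have "k div 2 < t" "k \<in> {2 * (k div 2), 2 * (k div 2) + 1}" using that by auto
    then show ?thesis using fm by blast
  qed
  have inj: "inj_on f {..<2 * t}"
  proof (rule inj_onI)
    fix k l assume kl: "k \<in> {..<2 * t}" "l \<in> {..<2 * t}" "f k = f l"
    have "h (k div 2) = h (l div 2)"
      using a kl fk[of k] fk[of l] hE[of "k div 2"] hE[of "l div 2"]
      by (fastforce simp: pairwise_def disjnt_def)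
    then have "k div 2 = l div 2"
      using h kl by (auto simp: bij_betw_def inj_on_def)
    moreover have "even k \<longleftrightarrow> even l"
    proof -
      have "k div 2 < t" using kl(1) by auto
      then have "p (h (k div 2)) \<noteq> q (h (k div 2))" using pq hE by blast
      with kl(3) calculation show ?thesis by (auto simp: f_def split: if_splits)
    qed
    ultimately show "k = l" by presburger
  qed
  have "edges (matching_graph t) = (\<lambda>i. {2 * i, 2 * i + 1}) ` {..<t}"
    by (auto simp: matching_graph_def)
  then have ed: "(\<lambda>e. f ` e) ` edges (matching_graph t) = edges G"
    using bij_betw_imp_surj_on[OF h] fm by (simp add: image_image del: image_insert)
  have "f ` {..<2 * t} = verts G"
  proof
    show "f ` {..<2 * t} \<subseteq> verts G"
    proof (rule image_subsetI)
      fix k assume "k \<in> {..<2 * t}"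
      then have "f k \<in> h (k div 2)" "h (k div 2) \<in> edges G" using fk hE by auto
      then show "f k \<in> verts G" using a by blast
    qed
    show "verts G \<subseteq> f ` {..<2 * t}"
    proof
      fix v assume "v \<in> verts G"
      then obtain e where e: "e \<in> edges G" "v \<in> e" using a by auto
      then obtain i where i: "i < t" "e = h i" using bij_betw_imp_surj_on[OF h] by blast
      have "v \<in> f ` {2 * i, 2 * i + 1}" using e(2) i fm[OF i(1)] by blast
      moreover have "{2 * i, 2 * i + 1} \<subseteq> {..<2 * t}" using i(1) by auto
      ultimately show "v \<in> f ` {..<2 * t}" by blast
    qed
  qed
  with inj ed show "isomorphic (matching_graph t) G"
    unfolding isomorphic_def bij_betw_def by (auto simp: matching_graph_def)
qed

lemma subgraph_of_edges:
  assumes "simple_graph H" "M \<subseteq> edges H" "N \<subseteq> edges H" "\<Union>N \<subseteq> \<Union>M"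
  shows "subgraph (\<Union>M, N) H"
proof -
  have M: "\<Union>M \<subseteq> verts H" using assms simple_graph_edgeD(3) by blast
  then have "finite (\<Union>M)" using assms(1) by (auto simp: simple_graph_def intro: finite_subset)
  moreover have "e \<subseteq> \<Union>M \<and> finite e \<and> card e = 2" if "e \<in> N" for e
    using that assms simple_graph_edgeD[OF assms(1)] by blast
  ultimately show ?thesis
    using assms M unfolding subgraph_def by (auto simp: simple_graph_def nsets_def)
qed

lemma contains_copy_matching_graph_iff:
  assumes H: "simple_graph H"
  shows "contains_copy H (matching_graph t) \<longleftrightarrow>
           (\<exists>M\<subseteq>edges H. pairwise disjnt M \<and> card M = t)"
proof
  assume "contains_copy H (matching_graph t)"
  then obtain G where "subgraph G H" "isomorphic (matching_graph t) G"
    by (auto simp: contains_copy_def)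
  then show "\<exists>M\<subseteq>edges H. pairwise disjnt M \<and> card M = t"
    by (intro exI[of _ "edges G"]) (auto simp: subgraph_def isomorphic_matching_graph_iff)
next
  assume "\<exists>M\<subseteq>edges H. pairwise disjnt M \<and> card M = t"
  then obtain M where M: "M \<subseteq> edges H" "pairwise disjnt M" "card M = t" by blast
  have s: "subgraph (\<Union>M, M) H" using subgraph_of_edges[OF H M(1) M(1)] by simp
  then have "isomorphic (matching_graph t) (\<Union>M, M)"
    by (subst isomorphic_matching_graph_iff) (use M in \<open>auto simp: subgraph_def\<close>)
  with s show "contains_copy H (matching_graph t)" by (auto simp: contains_copy_def)
qed

text \<open>
  The condition forbidden in the definition of \<open>st(n, tK\<^sub>2)\<close>: some matching of size \<open>t\<close> is not
  an induced subgraph.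
\<close>

lemma contains_proper_copy_matching_graph_iff:
  assumes H: "simple_graph H"
  shows "(\<exists>F. subgraph F H \<and> card (verts F) = card (verts (matching_graph t)) \<and>
              contains_proper_copy F (matching_graph t)) \<longleftrightarrow>
         (\<exists>M\<subseteq>edges H. pairwise disjnt M \<and> card M = t \<and> (\<exists>e\<in>edges H - M. e \<subseteq> \<Union>M))"
    (is "?L \<longleftrightarrow> ?R")
proof
  assume ?L
  then obtain F G where F: "subgraph F H" "card (verts F) = card (verts (matching_graph t))"
    and G: "subgraph G F" "G \<noteq> F" "isomorphic (matching_graph t) G"
    unfolding contains_proper_copy_def by blast
  have sF: "simple_graph F" and sG: "simple_graph G" using F G by (auto simp: subgraph_def)
  \<comment> \<open>The copy \<open>G\<close> spans \<open>F\<close>, so that it is proper only by lacking an edge of \<open>F\<close>.\<close>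
  have "card (verts G) = card (verts (matching_graph t))"
    using G(3) by (auto simp: isomorphic_def bij_betw_same_card)
  then have v: "verts G = verts F"
    using F G by (metis card_subset_eq simple_graph_def subgraph_def)
  with G have "edges G \<subset> edges F" by (auto simp: subgraph_def prod_eq_iff)
  then obtain e where e: "e \<in> edges F" "e \<notin> edges G" by auto
  have "pairwise disjnt (edges G) \<and> card (edges G) = t \<and> verts G = \<Union>(edges G)"
    using G(3) isomorphic_matching_graph_iff[OF sG] by blast
  moreover have "e \<subseteq> \<Union>(edges G)" using simple_graph_edgeD(3)[OF sF e(1)] v calculation by simp
  moreover have "edges G \<subseteq> edges H" "e \<in> edges H" using F G e by (auto simp: subgraph_def)
  ultimately show ?R using e by blast
next
  assume ?R
  then obtain M e where M: "M \<subseteq> edges H" "pairwise disjnt M" "card M = t"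
    and e: "e \<in> edges H" "e \<notin> M" "e \<subseteq> \<Union>M" by blast
  let ?F = "(\<Union>M, insert e M)"
  have sF: "subgraph ?F H" by (rule subgraph_of_edges[OF H M(1)]) (use M e in auto)
  have sG: "subgraph (\<Union>M, M) ?F"
    using sF subgraph_of_edges[OF H M(1) M(1)] by (auto simp: subgraph_def)
  have iso: "isomorphic (matching_graph t) (\<Union>M, M)"
    by (subst isomorphic_matching_graph_iff) (use M sG in \<open>auto simp: subgraph_def\<close>)
  then have "card (verts ?F) = card (verts (matching_graph t))"
    by (auto simp: isomorphic_def bij_betw_same_card)
  moreover have "contains_proper_copy ?F (matching_graph t)"
    unfolding contains_proper_copy_def using sG iso e by blast
  ultimately show ?L using sF by blast
qed

lemma contains_copy_path_graph_4_iff: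
  assumes H: "simple_graph H"
  shows "contains_copy H (path_graph 4) \<longleftrightarrow>
           (\<exists>a b c d. distinct [a, b, c, d] \<and> {a, b} \<in> edges H \<and> {b, c} \<in> edges H \<and> {c, d} \<in> edges H)"
proof -
  have P: "path_graph 4 = ({0, 1, 2, 3}, {{0, 1}, {1, 2}, {2, 3}})"
  proof -
    have "{..<4::nat} = {0, 1, 2, 3}" by auto
    moreover have "{{i, i + 1} | i::nat. i + 1 < 4} = (\<lambda>i. {i, i + 1}) ` {0, 1, 2}"
      by (auto simp: less_Suc_eq numeral_eq_Suc)
    ultimately show ?thesis by (simp add: path_graph_def numeral_eq_Suc)
  qed
  show ?thesis
  proof
    assume "contains_copy H (path_graph 4)"
    then obtain G f where G: "subgraph G H" and f: "inj_on f {0, 1, 2, 3::nat}"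
      and e: "edges G = {{f 0, f 1}, {f 1, f 2}, {f 2, f 3}}"
      unfolding contains_copy_def isomorphic_def P by (auto simp: bij_betw_def)
    have "distinct [f 0, f 1, f 2, f 3]" using f by (simp add: inj_on_def)
    moreover have "{f 0, f 1} \<in> edges H" "{f 1, f 2} \<in> edges H" "{f 2, f 3} \<in> edges H"
      using G e by (auto simp: subgraph_def)
    ultimately show "\<exists>a b c d. distinct [a, b, c, d] \<and>
        {a, b} \<in> edges H \<and> {b, c} \<in> edges H \<and> {c, d} \<in> edges H" by blast
  next
    assume "\<exists>a b c d. distinct [a, b, c, d] \<and>
        {a, b} \<in> edges H \<and> {b, c} \<in> edges H \<and> {c, d} \<in> edges H"
    then obtain a b c d where d: "distinct [a, b, c, d]"
      and E: "{{a, b}, {b, c}, {c, d}} \<subseteq> edges H" by blast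
    let ?G = "(\<Union>{{a, b}, {b, c}, {c, d}}, {{a, b}, {b, c}, {c, d}})"
    have "subgraph ?G H" by (rule subgraph_of_edges[OF H E E]) simp
    moreover have "isomorphic (path_graph 4) ?G"
      unfolding isomorphic_def P using d
      by (intro exI[of _ "(!) [a, b, c, d]"]) (auto simp: bij_betw_def inj_on_def numeral_eq_Suc)
    ultimately show "contains_copy H (path_graph 4)" by (auto simp: contains_copy_def)
  qed
qed

lemma contains_proper_copy_matching_graph_2_iff:
  assumes H: "simple_graph H"
  shows "(\<exists>F. subgraph F H \<and> card (verts F) = card (verts (matching_graph 2)) \<and>
              contains_proper_copy F (matching_graph 2)) \<longleftrightarrow> contains_copy H (path_graph 4)"
  unfolding contains_proper_copy_matching_graph_iff[OF H] contains_copy_path_graph_4_iff[OF H]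
proof (intro iffI; elim exE bexE conjE)
  fix M e assume M: "M \<subseteq> edges H" "pairwise disjnt M" "card M = 2"
    and e: "e \<in> edges H - M" "e \<subseteq> \<Union>M"
  from M(3) obtain p q where pq: "M = {p, q}" "p \<noteq> q" by (auto simp: card_2_iff)
  obtain x y where xy: "e = {x, y}" "x \<noteq> y" using simple_graph_edge[OF H, of e] e by blast
  have dj: "p \<inter> q = {}" using M pq by (auto simp: pairwise_def disjnt_def)
  have pqE: "p \<in> edges H" "q \<in> edges H" using M pq by auto
  have path: "\<exists>a b c d. distinct [a, b, c, d] \<and>
      {a, b} \<in> edges H \<and> {b, c} \<in> edges H \<and> {c, d} \<in> edges H"
    if "p = {u, v}" "q = {w, z}" "u \<noteq> v" "w \<noteq> z" "{v, w} = e" for u v w z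
  proof -
    have "distinct [u, v, w, z]" using that(1-4) dj by auto
    moreover have "{u, v} \<in> edges H" "{v, w} \<in> edges H" "{w, z} \<in> edges H"
      using that pqE e(1) by auto
    ultimately show ?thesis by blast
  qed
  have "\<not> (x \<in> r \<and> y \<in> r)" if r: "r \<in> edges H" "r \<in> M" for r
  proof
    assume as: "x \<in> r \<and> y \<in> r"
    then obtain w where "r = {x, w}" using simple_graph_edge_at[OF H r(1), of x] by blast
    with as xy have "r = e" by auto
    with r(2) e(1) show False by blast
  qed
  then have "(x \<in> p \<and> y \<in> q) \<or> (x \<in> q \<and> y \<in> p)"
    using e(2) pq pqE xy by auto
  then show "\<exists>a b c d. distinct [a, b, c, d] \<and>
      {a, b} \<in> edges H \<and> {b, c} \<in> edges H \<and> {c, d} \<in> edges H"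
  proof
    assume as: "x \<in> p \<and> y \<in> q"
    obtain u where u: "p = {x, u}" "u \<noteq> x" using simple_graph_edge_at[OF H pqE(1)] as by blast
    obtain z where z: "q = {y, z}" "z \<noteq> y" using simple_graph_edge_at[OF H pqE(2)] as by blast
    show ?thesis by (rule path[of u x y z]) (use u z xy in auto)
  next
    assume as: "x \<in> q \<and> y \<in> p"
    obtain u where u: "p = {y, u}" "u \<noteq> y" using simple_graph_edge_at[OF H pqE(1)] as by blast
    obtain z where z: "q = {x, z}" "z \<noteq> x" using simple_graph_edge_at[OF H pqE(2)] as by blast
    show ?thesis by (rule path[of u y x z]) (use u z xy in auto)
  qed
next
  fix a b c d assume "distinct [a, b, c, d]" "{a, b} \<in> edges H" "{b, c} \<in> edges H" "{c, d} \<in> edges H"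
  then show "\<exists>M\<subseteq>edges H. pairwise disjnt M \<and> card M = 2 \<and> (\<exists>e\<in>edges H - M. e \<subseteq> \<Union>M)"
    by (intro exI[of _ "{{a, b}, {c, d}}"] conjI bexI[of _ "{b, c}"])
       (auto simp: pairwise_def disjnt_def doubleton_eq_iff)
qed

section \<open>Edge bounds\<close>

text \<open>
  Induction on the number of vertices, removing a union \<open>S\<close> of components: a triangle, or a vertex
  together with its neighbours, which span a star.
\<close>

lemma path_free_card_edges:
  assumes "simple_graph (V, E)"
    and "\<And>a b c d. distinct [a, b, c, d] \<Longrightarrow> {a, b} \<in> E \<Longrightarrow> {b, c} \<in> E \<Longrightarrow> {c, d} \<in> E \<Longrightarrow> False"
  shows "card E \<le> card V \<and> (card E = card V \<longrightarrow> 3 dvd card V)"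
  using assms
proof (induction "card V" arbitrary: V E rule: less_induct)
  case less
  have fV: "finite V" using less.prems(1) by (simp add: simple_graph_def)
  have fE: "finite E" using simple_graph_finite_edges[OF less.prems(1)] by simp
  note edge = simple_graph_edge[OF less.prems(1), simplified]
  note edge_at = simple_graph_edge_at[OF less.prems(1), simplified]
  have step: ?case
    if S: "S \<subseteq> V" "S \<noteq> {}" and closed: "\<And>e. e \<in> E \<Longrightarrow> e \<subseteq> S \<or> e \<inter> S = {}"
      and c: "card {e \<in> E. e \<subseteq> S} < card S \<or> card {e \<in> E. e \<subseteq> S} = 3 \<and> card S = 3" for S
  proof -
    have fS: "finite S" using S fV finite_subset by blast
    have less_V: "card (V - S) < card V"
      using S fV by (intro psubset_card_mono) auto
    let ?E = "{e \<in> E. e \<inter> S = {}}"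
    have "simple_graph (V - S, ?E)"
      using less.prems(1) by (auto simp: simple_graph_def nsets_def)
    then have IH: "card ?E \<le> card (V - S) \<and> (card ?E = card (V - S) \<longrightarrow> 3 dvd card (V - S))"
      using less.prems(2) by (intro less.hyps[OF less_V]) auto
    have "E = {e \<in> E. e \<subseteq> S} \<union> ?E" using closed by blast
    moreover have "{e \<in> E. e \<subseteq> S} \<inter> ?E = {}" by (auto dest!: edge)
    ultimately have "card E = card {e \<in> E. e \<subseteq> S} + card ?E"
      using fE by (metis (no_types, lifting) card_Un_disjoint finite_Un)
    moreover have "card V = card S + card (V - S)"
      using S fV fS card_mono[OF fV S(1)] by (simp add: card_Diff_subset)
    ultimately show ?thesis using IH c by auto
  qed
  consider (empty) "E = {}"
    | (tri) a b c where "{a, b} \<in> E" "{b, c} \<in> E" "{a, c} \<in> E" "a \<noteq> b" "b \<noteq> c" "a \<noteq> c"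
    | (free) "E \<noteq> {}" "\<And>a b c. a \<noteq> b \<Longrightarrow> b \<noteq> c \<Longrightarrow> a \<noteq> c \<Longrightarrow> {a, b} \<in> E \<Longrightarrow> {b, c} \<in> E \<Longrightarrow> {a, c} \<in> E \<Longrightarrow> False"
    by blast
  then show ?case
  proof cases
    case empty
    then show ?thesis by simp
  next
    case tri
    let ?S = "{a, b, c}"
    have E: "{e \<in> E. e \<subseteq> ?S} = {{a, b}, {b, c}, {a, c}}"
    proof
      show "{e \<in> E. e \<subseteq> ?S} \<subseteq> {{a, b}, {b, c}, {a, c}}"
      proof
        fix e assume e: "e \<in> {e \<in> E. e \<subseteq> ?S}"
        then obtain x y where xy: "e = {x, y}" "x \<noteq> y" using edge[of e] by blast
        with e have "x \<in> ?S" "y \<in> ?S" by auto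
        with xy show "e \<in> {{a, b}, {b, c}, {a, c}}" by (auto simp: doubleton_eq_iff)
      qed
    qed (use tri in auto)
    have "card {{a, b}, {b, c}, {a, c}} = 3" "card ?S = 3"
      using tri by (auto simp: doubleton_eq_iff card_insert_if)
    moreover have "?S \<subseteq> V" using tri simple_graph_edgeD(3)[OF less.prems(1)] by auto
    moreover have "e \<subseteq> ?S \<or> e \<inter> ?S = {}" if e: "e \<in> E" for e
    proof (rule ccontr)
      assume "\<not> (e \<subseteq> ?S \<or> e \<inter> ?S = {})"
      then obtain x y' where x: "x \<in> e" "x \<in> ?S" and y': "y' \<in> e" "y' \<notin> ?S" by blast
      obtain y where "e = {x, y}" using edge_at[OF e x(1)] by blast
      with x y' e have xy: "{x, y} \<in> E" "x \<in> ?S" "y \<notin> ?S" by auto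
      have ins: "{b, a} \<in> E" "{c, b} \<in> E" "{c, a} \<in> E" "{y, x} \<in> E"
        using tri xy by (simp_all add: insert_commute)
      from xy(2) consider "x = a" | "x = b" | "x = c" by blast
      then show False
        by cases (use less.prems(2)[of y a b c] less.prems(2)[of y b a c] less.prems(2)[of y c a b]
            tri xy ins in auto)
    qed
    ultimately show ?thesis using E by (intro step[of ?S]) auto
  next
    case free
    \<comment> \<open>The centre \<open>a\<close> of the star must have degree at least two, unless the graph is a matching.\<close>
    obtain a b where ab: "{a, b} \<in> E" "a \<noteq> b"
      and deg: "(\<exists>c. c \<noteq> b \<and> {a, c} \<in> E) \<or> (\<forall>x y z. {x, y} \<in> E \<longrightarrow> {x, z} \<in> E \<longrightarrow> y = z)"
    proof (cases "\<forall>x y z. {x, y} \<in> E \<longrightarrow> {x, z} \<in> E \<longrightarrow> y = z")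
      case True
      from free(1) obtain e where "e \<in> E" by blast
      then show ?thesis using that True edge by metis
    next
      case False
      then obtain x y z where xyz: "{x, y} \<in> E" "{x, z} \<in> E" "y \<noteq> z" by blast
      have "x \<noteq> y" using xyz(1) edge[OF xyz(1)] by (metis doubleton_eq_iff)
      moreover have "\<exists>c. c \<noteq> y \<and> {x, c} \<in> E" using xyz by metis
      ultimately show ?thesis by (intro that[OF xyz(1)]) simp_all
    qed
    define N where "N = {v. {a, v} \<in> E}"
    have aN: "a \<notin> N" unfolding N_def using edge[of "{a}"] by fastforce
    have NV: "insert a N \<subseteq> V"
      using ab simple_graph_edgeD(3)[OF less.prems(1)] by (fastforce simp: N_def)
    have fN: "finite N" using finite_subset[OF NV fV] by simp
    have star: "a \<in> e" if e: "e \<in> E" "e \<inter> insert a N \<noteq> {}" for e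
    proof (rule ccontr)
      assume ae: "a \<notin> e"
      with e obtain x where x: "x \<in> e" "x \<in> N" by blast
      obtain y where "e = {x, y}" "y \<noteq> x" using edge_at[OF e(1) x(1)] by blast
      with x have xy: "e = {x, y}" "x \<noteq> y" "x \<in> N" by auto
      then have ax: "{a, x} \<in> E" "x \<noteq> a" "y \<noteq> a" using ae by (auto simp: N_def)
      have "\<not> (\<forall>x y z. {x, y} \<in> E \<longrightarrow> {x, z} \<in> E \<longrightarrow> y = z)"
        using ax xy e(1) by (metis insert_commute)
      \<comment> \<open>An edge \<open>xy\<close> at a neighbour \<open>x\<close> of \<open>a\<close> avoiding \<open>a\<close> would give, with another
        neighbour \<open>z\<close> of \<open>a\<close>, the triangle \<open>axy\<close> or the path \<open>zaxy\<close>.\<close>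
      with deg ab obtain z where z: "{a, z} \<in> E" "z \<noteq> x" by metis
      have za: "z \<noteq> a" using z aN by (auto simp: N_def)
      show False
      proof (cases "z = y")
        case True
        then show False using free(2)[of a x y] ax xy z e by auto
      next
        case False
        then show False using less.prems(2)[of z a x y] ax xy z za e by (auto simp: insert_commute)
      qed
    qed
    have Ea: "e \<in> (\<lambda>v. {a, v}) ` N" if "e \<in> E" "a \<in> e" for e
      using edge_at[OF that] that(1) by (metis N_def image_eqI mem_Collect_eq)
    have sub: "{e \<in> E. e \<subseteq> insert a N} \<subseteq> (\<lambda>v. {a, v}) ` N"
    proof
      fix e assume "e \<in> {e \<in> E. e \<subseteq> insert a N}"
      then have "e \<in> E" "e \<inter> insert a N \<noteq> {}" using edge by blast+
      then show "e \<in> (\<lambda>v. {a, v}) ` N" using star Ea by blast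
    qed
    have "card {e \<in> E. e \<subseteq> insert a N} \<le> card N"
      using card_mono[OF _ sub] card_image_le[OF fN, of "\<lambda>v. {a, v}"] fN by simp
    then have "card {e \<in> E. e \<subseteq> insert a N} < card (insert a N)" using aN fN by simp
    moreover have "e \<subseteq> insert a N \<or> e \<inter> insert a N = {}" if "e \<in> E" for e
      using star[OF that] Ea[OF that] by blast
    ultimately show ?thesis using NV by (intro step[of "insert a N"]) auto
  qed
qed

text \<open>Pairwise intersecting edges have a common vertex or lie within a triangle.\<close>

lemma intersecting_card_edges:
  assumes H: "simple_graph (V, E)"
    and int: "\<And>e f. e \<in> E \<Longrightarrow> f \<in> E \<Longrightarrow> e \<inter> f \<noteq> {}"
  shows "card E \<le> max 3 (card V - 1)"
proof (cases "\<exists>v\<in>V. \<forall>e\<in>E. v \<in> e")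
  case True
  then obtain v where v: "v \<in> V" "\<forall>e\<in>E. v \<in> e" by blast
  have "E \<subseteq> (\<lambda>w. {v, w}) ` (V - {v})"
  proof
    fix e assume e: "e \<in> E"
    then obtain x y where "e = {x, y}" "x \<noteq> y" "x \<in> V" "y \<in> V"
      using simple_graph_edge[OF H, of e] by auto
    moreover have "v \<in> e" using v e by blast
    ultimately show "e \<in> (\<lambda>w. {v, w}) ` (V - {v})" by (auto simp: image_iff insert_commute)
  qed
  moreover have "finite V" using H by (simp add: simple_graph_def)
  ultimately have "card E \<le> card (V - {v})" by (simp add: surj_card_le)
  then show ?thesis using v(1) by simp
next
  case False
  show ?thesis
  proof (cases "E = {}")
    case nonempty: False
    note edge = simple_graph_edge[OF H, simplified]
    note edge_at = simple_graph_edge_at[OF H, simplified]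
    from nonempty obtain e where e: "e \<in> E" by blast
    then obtain a b where ab: "e = {a, b}" "a \<noteq> b" "a \<in> V" "b \<in> V" using edge by metis
    obtain f where f: "f \<in> E" "a \<notin> f" using False ab by blast
    with int[OF e f(1)] ab have "b \<in> f" by blast
    then obtain c where "f = {b, c}" "c \<noteq> b" using edge_at[OF f(1)] by blast
    with f have c: "f = {b, c}" "c \<noteq> b" "c \<noteq> a" by auto
    obtain g where g: "g \<in> E" "b \<notin> g" using False ab by blast
    have g': "a \<in> g" "c \<in> g" using int[OF e g(1)] int[OF f(1) g(1)] g ab c by auto
    have "E \<subseteq> {{a, b}, {b, c}, {a, c}}"
    proof
      fix h assume h: "h \<in> E"
      obtain x y where xy: "h = {x, y}" "x \<noteq> y" using edge[OF h] by blast
      obtain z where "g = {a, z}" using edge_at[OF g(1) g'(1)] by blast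
      then have "g = {a, c}" using g' c by auto
      then have "x \<in> {a, b} \<or> y \<in> {a, b}" "x \<in> {b, c} \<or> y \<in> {b, c}" "x \<in> {a, c} \<or> y \<in> {a, c}"
        using int[OF h e] int[OF h f(1)] int[OF h g(1)] ab(1) c(1) xy(1) by auto
      then have "x \<in> {a, b, c}" "y \<in> {a, b, c}" using xy(2) ab(2) c(2,3) by auto
      with xy show "h \<in> {{a, b}, {b, c}, {a, c}}" by (auto simp: doubleton_eq_iff)
    qed
    then have "card E \<le> card {{a, b}, {b, c}, {a, c}}" by (intro card_mono) auto
    also have "\<dots> \<le> 3" by (simp add: card_insert_if)
    finally show ?thesis by simp
  qed simp
qed

text \<open>
  If every matching of size \<open>t\<close> is induced and there is one, then a maximum matching leaves room for
  few further edges.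
\<close>

lemma induced_matchings_card_edges:
  assumes H: "simple_graph (V, E)" and t: "t \<ge> 2"
    and ind: "\<And>M e. M \<subseteq> E \<Longrightarrow> pairwise disjnt M \<Longrightarrow> card M = t \<Longrightarrow> e \<in> E \<Longrightarrow> e \<subseteq> \<Union>M \<Longrightarrow> e \<in> M"
    and ex: "M0 \<subseteq> E" "pairwise disjnt M0" "card M0 = t"
  shows "card E + 3 * t \<le> 2 * card V"
proof -
  have fV: "finite V" using H by (simp add: simple_graph_def)
  have fE: "finite E" using simple_graph_finite_edges[OF H] by simp
  note edge = simple_graph_edge[OF H, simplified]
  note edge_at = simple_graph_edge_at[OF H, simplified]
  note edgeD = simple_graph_edgeD[OF H, simplified]
  \<comment> \<open>Larger matchings are induced too: an edge that they cover is covered by two of their edges,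
    and these extend to a matching of size exactly \<open>t\<close>.\<close>
  have ind': "e \<in> N" if N: "N \<subseteq> E" "pairwise disjnt N" "card N \<ge> t" and e: "e \<in> E" "e \<subseteq> \<Union>N" for N e
  proof -
    obtain x y where xy: "e = {x, y}" using edge[OF e(1)] by blast
    then obtain p q where pq: "p \<in> N" "x \<in> p" "q \<in> N" "y \<in> q" using e by auto
    have "card {p, q} \<le> 2" by (simp add: card_insert_if)
    then obtain N' where N': "{p, q} \<subseteq> N'" "N' \<subseteq> N" "card N' = t"
      using exists_subset_between[of "{p, q}" t N] t N pq finite_subset[OF N(1) fE] by auto
    have "e \<in> N'"
      by (rule ind) (use N N' pq xy e in \<open>auto intro: pairwise_subset\<close>)
    then show ?thesis using N' by blast
  qed
  define P where "P M \<longleftrightarrow> M \<subseteq> E \<and> pairwise disjnt M" for M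
  have "P M0" using ex by (simp add: P_def)
  moreover have "\<forall>M. P M \<longrightarrow> card M < card E + 1" by (auto simp: P_def fE card_mono le_imp_less_Suc)
  ultimately obtain M where PM: "P M" and Mmax: "\<And>N. P N \<Longrightarrow> card N \<le> card M"
    using Lattices_Big.ex_has_greatest_nat[of P M0 card "card E + 1"] by auto
  have M: "M \<subseteq> E" "pairwise disjnt M" using PM by (auto simp: P_def)
  have fM: "finite M" using M fE finite_subset by blast
  have tM: "t \<le> card M" using Mmax[of M0] ex by (simp add: P_def)
  define U where "U = V - \<Union>M"
  have "card (\<Union>M) = sum card M" using M edgeD by (intro card_Union_disjoint) auto
  also have "\<dots> = 2 * card M" using M edgeD by (subst sum.cong[of M M card "\<lambda>_. 2"]) auto
  finally have cM: "card (\<Union>M) = 2 * card M" .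
  have sub: "\<Union>M \<subseteq> V" using M edgeD by blast
  have cU: "card U + 2 * card M = card V"
    using card_Diff_subset[OF finite_subset[OF sub fV] sub] card_mono[OF fV sub] cM by (simp add: U_def)
  have meets: "e \<inter> \<Union>M \<noteq> {}" if "e \<in> E" for e
  proof
    assume dj: "e \<inter> \<Union>M = {}"
    then have "e \<notin> M" using edge[OF that] by blast
    moreover have "P (insert e M)"
      using M that dj by (auto simp: P_def pairwise_insert disjnt_def)
    ultimately show False using Mmax[of "insert e M"] fM by simp
  qed
  have deg: "card {e \<in> E. u \<in> e} \<le> 2" if u: "u \<in> U" for u
  proof (cases "{e \<in> E. u \<in> e} = {}")
    case False
    have nb: "\<exists>a m. e = {u, a} \<and> a \<in> m \<and> m \<in> M" if e: "e \<in> E" "u \<in> e" for e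
    proof -
      obtain a where "e = {u, a}" using edge_at[OF e] by blast
      then show ?thesis using meets[OF e(1)] u by (auto simp: U_def)
    qed
    from False nb obtain a m where a: "{u, a} \<in> E" "a \<in> m" "m \<in> M" by blast
    have "{e \<in> E. u \<in> e} \<subseteq> (\<lambda>v. {u, v}) ` m"
    proof
      fix e assume "e \<in> {e \<in> E. u \<in> e}"
      with nb obtain a' m' where a': "e = {u, a'}" "e \<in> E" "a' \<in> m'" "m' \<in> M" by blast
      have "m' = m"
      proof (rule ccontr)
        assume ne: "m' \<noteq> m"
        \<comment> \<open>Exchanging \<open>m\<close> for \<open>ua\<close> keeps the size, and \<open>m'\<close> is kept; so \<open>ua'\<close> is an edge covered
          by the new matching but not in it.\<close>
        let ?N = "insert {u, a} (M - {m})"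
        have uM: "\<And>p. p \<in> M \<Longrightarrow> u \<notin> p" using u by (auto simp: U_def)
        have am: "\<And>p. p \<in> M \<Longrightarrow> p \<noteq> m \<Longrightarrow> a \<notin> p"
          using M(2) a by (auto simp: pairwise_def disjnt_def)
        have "pairwise disjnt ?N"
          using M(2) uM am by (auto simp: pairwise_insert disjnt_def pairwise_def)
        moreover have "card ?N = card M"
          using card_Suc_Diff1[OF fM a(3)] uM[of "{u, a}"] fM
          by (auto simp: card_insert_if simp del: card_Diff_insert)
        moreover have "e \<subseteq> \<Union>?N" using a' ne by auto
        moreover have "?N \<subseteq> E" using a(1) M(1) by blast
        ultimately have "e \<in> ?N" using tM a'(2) by (intro ind'[of ?N]) simp_all
        then have "{u, a'} = {u, a}" using uM a' by auto
        then have "a' = a" by (auto simp: doubleton_eq_iff)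
        then show False using am a' ne by blast
      qed
      then show "e \<in> (\<lambda>v. {u, v}) ` m" using a' by blast
    qed
    moreover have "card m = 2" "finite m" using a M edgeD by auto
    ultimately show ?thesis by (metis surj_card_le)
  qed (simp only: card.empty)
  have fU: "finite U" using fV by (simp add: U_def)
  have "E \<subseteq> M \<union> (\<Union>u\<in>U. {e \<in> E. u \<in> e})"
  proof
    fix e assume e: "e \<in> E"
    show "e \<in> M \<union> (\<Union>u\<in>U. {e \<in> E. u \<in> e})"
    proof (cases "e \<subseteq> \<Union>M")
      case True
      then show ?thesis using ind'[OF M tM e] by blast
    next
      case False
      then show ?thesis using e edgeD(3)[OF e] by (auto simp: U_def)
    qed
  qed
  then have "card E \<le> card (M \<union> (\<Union>u\<in>U. {e \<in> E. u \<in> e}))"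
    using fM fU fE by (intro card_mono) auto
  also have "\<dots> \<le> card M + card (\<Union>u\<in>U. {e \<in> E. u \<in> e})" by (rule card_Un_le)
  also have "\<dots> \<le> card M + (\<Sum>u\<in>U. card {e \<in> E. u \<in> e})" by (simp add: card_UN_le fU)
  also have "\<dots> \<le> card M + 2 * card U" using sum_bounded_above[of U "\<lambda>u. card {e \<in> E. u \<in> e}" 2] deg by (auto simp: mult.commute)
  finally show ?thesis using cU tM by linarith
qed

section \<open>Extremal numbers\<close>

lemma ex_number_ge:
  assumes "simple_graph (H :: nat graph)" "card (verts H) = n" "\<not> contains_copy H G"
  shows "card (edges H) \<le> ex_number n G"
  unfolding ex_number_def
  by (rule Max_ge[OF finite_edge_counts]) (use assms in blast)

lemma ex_number_le:
  assumes "edges G \<noteq> {}"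
    and "\<And>H :: nat graph. simple_graph H \<Longrightarrow> card (verts H) = n \<Longrightarrow> \<not> contains_copy H G \<Longrightarrow> card (edges H) \<le> m"
  shows "ex_number n G \<le> m"
  unfolding ex_number_def
  using assms by (subst Max_le_iff[OF finite_edge_counts ex_number_nonempty]) auto

lemma edges_matching_graph_nonempty: "t > 0 \<Longrightarrow> edges (matching_graph t) \<noteq> {}"
  by (auto simp: matching_graph_def)

lemma edges_path_graph_nonempty: "k > 1 \<Longrightarrow> edges (path_graph k) \<noteq> {}"
  by (auto simp: path_graph_def intro: exI[of _ 0])

lemma ex_number_matching_graph_2:
  assumes "n \<ge> 4"
  shows "ex_number n (matching_graph 2) = n - 1"
proof (rule antisym)
  show "ex_number n (matching_graph 2) \<le> n - 1"
  proof (rule ex_number_le)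
    fix H :: "nat graph"
    assume H: "simple_graph H" "card (verts H) = n" "\<not> contains_copy H (matching_graph 2)"
    have "e \<inter> f \<noteq> {}" if "e \<in> edges H" "f \<in> edges H" for e f
    proof
      assume dj: "e \<inter> f = {}"
      then have "e \<noteq> f" using simple_graph_edge[OF H(1) that(1)] by blast
      with dj that have "{e, f} \<subseteq> edges H \<and> pairwise disjnt {e, f} \<and> card {e, f} = 2"
        by (auto simp: pairwise_def disjnt_def)
      with H(3) show False unfolding contains_copy_matching_graph_iff[OF H(1)] by blast
    qed
    then have "card (edges H) \<le> max 3 (n - 1)"
      using intersecting_card_edges[of "verts H" "edges H"] H by simp
    with assms show "card (edges H) \<le> n - 1" by simp
  qed (rule edges_matching_graph_nonempty, simp)
next
  \<comment> \<open>The star with centre \<open>0\<close>.\<close>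
  let ?E = "(\<lambda>j. {0, j}) ` {1..<n}"
  let ?H = "({..<n}, ?E) :: nat graph"
  have H: "simple_graph ?H" using assms by (auto simp: simple_graph_def nsets_def card_insert_if)
  have "card ?E = n - 1" by (subst card_image) (auto simp: inj_on_def doubleton_eq_iff)
  moreover have "\<not> contains_copy ?H (matching_graph 2)"
  proof
    assume "contains_copy ?H (matching_graph 2)"
    then obtain M where M: "M \<subseteq> ?E" "pairwise disjnt M" "card M = 2"
      unfolding contains_copy_matching_graph_iff[OF H] by auto
    from M(3) obtain p q where pq: "p \<in> M" "q \<in> M" "p \<noteq> q" by (auto simp: card_2_iff)
    then have "p \<inter> q = {}" using M(2) by (auto simp: pairwise_def disjnt_def)
    moreover have "0 \<in> p" "0 \<in> q" using pq M(1) by auto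
    ultimately show False by blast
  qed
  ultimately show "n - 1 \<le> ex_number n (matching_graph 2)"
    using ex_number_ge[OF H, of n "matching_graph 2"] by simp
qed

text \<open>A path on four vertices contains two disjoint edges.\<close>

lemma ex_number_matching_graph_2_le_path_graph_4:
  "ex_number n (matching_graph 2) \<le> ex_number n (path_graph 4)"
proof (rule ex_number_le)
  fix H :: "nat graph"
  assume H: "simple_graph H" "card (verts H) = n" "\<not> contains_copy H (matching_graph 2)"
  have "\<not> contains_copy H (path_graph 4)"
    using H(3) contains_copy_matching_graph_iff[OF H(1), of 2]
      contains_proper_copy_matching_graph_2_iff[OF H(1)]
      contains_proper_copy_matching_graph_iff[OF H(1), of 2] by blast
  then show "card (edges H) \<le> ex_number n (path_graph 4)" using ex_number_ge H by blast
qed (rule edges_matching_graph_nonempty, simp)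

lemma ex_number_path_graph_4:
  assumes "n \<ge> 4"
  shows "ex_number n (path_graph 4) = (if 3 dvd n then n else n - 1)"
proof (rule antisym)
  show "ex_number n (path_graph 4) \<le> (if 3 dvd n then n else n - 1)"
  proof (rule ex_number_le)
    fix H :: "nat graph"
    assume H: "simple_graph H" "card (verts H) = n" "\<not> contains_copy H (path_graph 4)"
    have "card (edges H) \<le> n \<and> (card (edges H) = n \<longrightarrow> 3 dvd n)"
      using path_free_card_edges[of "verts H" "edges H"] H
      unfolding contains_copy_path_graph_4_iff[OF H(1)] by auto
    then show "card (edges H) \<le> (if 3 dvd n then n else n - 1)" by auto
  qed (rule edges_path_graph_nonempty, simp)
next
  show "(if 3 dvd n then n else n - 1) \<le> ex_number n (path_graph 4)"
  proof (cases "3 dvd n")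
    case False
    then show ?thesis
      using ex_number_matching_graph_2[OF assms] ex_number_matching_graph_2_le_path_graph_4[of n] by simp
  next
    case True
    \<comment> \<open>Disjoint triangles on \<open>3q, 3q + 1, 3q + 2\<close>; each edge is \<open>?g k\<close> for exactly one vertex \<open>k\<close>,
      which it joins to the next vertex in the cyclic order of its triangle.\<close>
    let ?g = "\<lambda>k. if k mod 3 = 2 then {k, k - 2} else {k, k + 1 :: nat}"
    let ?E = "?g ` {..<n}"
    let ?H = "({..<n}, ?E) :: nat graph"
    have in_n: "k + 1 < n" if "k < n" "k mod 3 \<noteq> 2" for k
      using that True by presburger
    have H: "simple_graph ?H"
      using in_n by (auto simp: simple_graph_def nsets_def card_insert_if)
    have "inj_on ?g {..<n}"
      by (auto simp: inj_on_def doubleton_eq_iff split: if_splits; presburger)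
    from card_image[OF this] have "card ?E = n" by (simp only: card_lessThan)
    moreover have "\<not> contains_copy ?H (path_graph 4)"
    proof
      have block: "x div 3 = y div 3" if "{x, y} \<in> ?E" for x y
        using that by (auto simp: doubleton_eq_iff split: if_splits; presburger)
      assume "contains_copy ?H (path_graph 4)"
      then obtain a b c d where d: "distinct [a, b, c, d]"
        and "{a, b} \<in> ?E" "{b, c} \<in> ?E" "{c, d} \<in> ?E"
        unfolding contains_copy_path_graph_4_iff[OF H] snd_conv by blast
      then have "a div 3 = b div 3" "b div 3 = c div 3" "c div 3 = d div 3" using block by blast+
      moreover have "v \<in> {3 * (v div 3), 3 * (v div 3) + 1, 3 * (v div 3) + 2}" for v :: nat
        by simp presburger
      ultimately have "set [a, b, c, d] \<subseteq> set [3 * (a div 3), 3 * (a div 3) + 1, 3 * (a div 3) + 2]"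
        by (metis empty_set empty_subsetI insert_subset list.simps(15))
      then have "card (set [a, b, c, d]) \<le> length [3 * (a div 3), 3 * (a div 3) + 1, 3 * (a div 3) + 2]"
        by (meson List.finite_set card_length card_mono le_trans)
      with distinct_card[OF d] show False by simp
    qed
    ultimately show ?thesis using ex_number_ge[OF H, of n "path_graph 4"] True by simp
  qed
qed

text \<open>The two conditions on the host graph coincide.\<close>

lemma st_number_matching_graph_2: "st_number n (matching_graph 2) = ex_number n (path_graph 4)"
  unfolding st_number_def ex_number_def
  by (rule arg_cong[where f = Max]) (use contains_proper_copy_matching_graph_2_iff in blast)

lemma ex_number_matching_graph_ge:
  assumes "t \<ge> 3" "n \<ge> 2"
  shows "2 * (n - 2) \<le> ex_number n (matching_graph t)"
proof -
  \<comment> \<open>The complete bipartite graph with parts \<open>{0, 1}\<close> and \<open>{2..<n}\<close>; the edges of a matching meet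
    \<open>{0, 1}\<close> in different vertices.\<close>
  let ?E = "(\<lambda>(i, j). {i, j}) ` ({0, 1} \<times> {2..<n})"
  let ?H = "({..<n}, ?E) :: nat graph"
  have H: "simple_graph ?H" using assms by (auto simp: simple_graph_def nsets_def card_insert_if)
  have "inj_on (\<lambda>(i, j). {i, j}) ({0, 1::nat} \<times> {2..<n})"
    by (auto simp: inj_on_def doubleton_eq_iff)
  then have "card ?E = 2 * (n - 2)" by (simp add: card_image card_cartesian_product)
  moreover have "\<not> contains_copy ?H (matching_graph t)"
  proof
    assume "contains_copy ?H (matching_graph t)"
    then obtain M where M: "M \<subseteq> ?E" "pairwise disjnt M" "card M = t"
      unfolding contains_copy_matching_graph_iff[OF H] by auto
    define c where "c e = (if 0 \<in> e then 0 else 1::nat)" for e :: "nat set"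
    have c: "c e \<in> e" "c e \<in> {0, 1}" if "e \<in> M" for e
      using that M(1) by (auto simp: c_def)
    have "inj_on c M"
    proof (rule inj_onI)
      fix e f assume "e \<in> M" "f \<in> M" "c e = c f"
      then show "e = f" using M(2) c(1)[of e] c(1)[of f] by (auto simp: pairwise_def disjnt_def)
    qed
    moreover have "c ` M \<subseteq> {0, 1}" by (rule image_subsetI) (rule c(2))
    ultimately have "card M \<le> card {0, 1::nat}" by (rule card_inj_on_le) simp
    with M assms show False by simp
  qed
  ultimately show ?thesis using ex_number_ge[OF H, of n "matching_graph t"] by simp
qed

lemma st_number_matching_graph:
  assumes t: "t \<ge> 3" and n: "n \<ge> 2"
  shows "st_number n (matching_graph t) = ex_number n (matching_graph t)"
proof (rule antisym)
  have ne: "edges (matching_graph t) \<noteq> {}" using t by (intro edges_matching_graph_nonempty) simp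
  show "ex_number n (matching_graph t) \<le> st_number n (matching_graph t)"
    unfolding st_number_def ex_number_def
  proof (rule Max_mono[OF _ ex_number_nonempty[OF ne] finite_edge_counts])
    have "\<nexists>F. subgraph F H \<and> card (verts F) = card (verts (matching_graph t)) \<and>
            contains_proper_copy F (matching_graph t)"
      if "simple_graph H" "\<not> contains_copy H (matching_graph t)" for H :: "nat graph"
      using that contains_copy_matching_graph_iff[OF that(1)]
        contains_proper_copy_matching_graph_iff[OF that(1)] by blast
    then show "{m. \<exists>H :: nat graph. simple_graph H \<and> card (verts H) = n \<and> card (edges H) = m \<and>
          \<not> contains_copy H (matching_graph t)}
        \<subseteq> {m. \<exists>H :: nat graph. simple_graph H \<and> card (verts H) = n \<and> card (edges H) = m \<and>
            (\<nexists>F. subgraph F H \<and> card (verts F) = card (verts (matching_graph t)) \<and>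
                 contains_proper_copy F (matching_graph t))}"
      by blast
  qed
  have "card (edges H) \<le> ex_number n (matching_graph t)"
    if H: "simple_graph H" "card (verts H) = n"
      and F: "\<nexists>F. subgraph F H \<and> card (verts F) = card (verts (matching_graph t)) \<and>
                 contains_proper_copy F (matching_graph t)" for H :: "nat graph"
  proof (cases "contains_copy H (matching_graph t)")
    case False
    then show ?thesis using ex_number_ge H by blast
  next
    case True
    then obtain M where M: "M \<subseteq> edges H" "pairwise disjnt M" "card M = t"
      unfolding contains_copy_matching_graph_iff[OF H(1)] by blast
    have "card (edges H) + 3 * t \<le> 2 * card (verts H)"
    proof (rule induced_matchings_card_edges[OF _ _ _ M])
      show "e \<in> N" if "N \<subseteq> edges H" "pairwise disjnt N" "card N = t" "e \<in> edges H" "e \<subseteq> \<Union>N" for N e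
        using F that unfolding contains_proper_copy_matching_graph_iff[OF H(1)] by blast
    qed (use H t in auto)
    then show ?thesis using ex_number_matching_graph_ge[OF t n] H t by linarith
  qed
  then show "st_number n (matching_graph t) \<le> ex_number n (matching_graph t)"
    unfolding st_number_def
    by (subst Max_le_iff[OF finite_edge_counts st_number_nonempty[OF ne]]) auto
qed

theorem theorem12:
  fixes t n :: nat
  assumes "t \<ge> 2" and "n \<ge> 2 * t"
  shows "(t = 2 \<longrightarrow>
            (\<not> 3 dvd n \<longrightarrow>
               st_number n (matching_graph 2) = n - 1 \<and>
               n - 1 = ex_number n (path_graph 4) \<and>
               ex_number n (path_graph 4) = ex_number n (matching_graph 2)) \<and>
            (3 dvd n \<longrightarrow>
               st_number n (matching_graph 2) = n \<and>
               n = ex_number n (path_graph 4) \<and>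
               ex_number n (path_graph 4) = ex_number n (matching_graph 2) + 1)) \<and>
         (t \<ge> 3 \<longrightarrow> st_number n (matching_graph t) = ex_number n (matching_graph t))"
  using assms ex_number_path_graph_4[of n] ex_number_matching_graph_2[of n]
    st_number_matching_graph_2[of n] st_number_matching_graph[of t n]
  by auto

end
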